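(* Let $n\geq 3$ and $r\geq 2$ be integers. Then: (i) if $n\geq 4$ is even, the cycle $C_n$ is $(2r,r)$-star colorable; (ii) if $n\geq 2r+1$ is odd, $C_n$ is $(2r+1,r)$-star colorable; (iii) if $n\geq 3$ is odd, $C_n$ is $\left(2r+\left\lceil \frac{2r}{n-1}\right\rceil,r\right)$-star colorable.
   Context: $C_n$ denotes the cycle on $n$ vertices. A star edge coloring of a graph is a proper edge coloring such that no path or cycle with four edges uses at most two colors. For an edge coloring $f$ and a vertex $v$, $A_f(v)$ denotes the set of colors of edges incident to $v$. Two star edge colorings $f_1,f_2$ of $G$ are star compatible if $A_{f_1}(v)\cap A_{f_2}(v)=\emptyset$ for every vertex $v$. $G$ is $(k,t)$-star colorable if $G$ has $t$ pairwise star compatible star edge colorings $f_i:E(G)\to\{0,1,\ldots,k-1\}$, $1\le i\le t$. *)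

theory Defs
  imports Complex_Main
begin

text \<open>
  A finite simple graph is given by its vertex set \<open>V\<close> and its edge set \<open>E\<close>,
  an edge being the two-element set of its endpoints.
\<close>

definition simple_graph :: "'a set \<Rightarrow> 'a set set \<Rightarrow> bool" where
  "simple_graph V E \<longleftrightarrow> finite V \<and> (\<forall>e\<in>E. e \<subseteq> V \<and> card e = 2)"

text \<open>Paths and cycles are given by the lists of their (distinct) vertices.\<close>

definition path_edges :: "'a list \<Rightarrow> 'a set set" where
  "path_edges vs = {{vs ! i, vs ! Suc i} | i. Suc i < length vs}"

definition is_path :: "'a set \<Rightarrow> 'a set set \<Rightarrow> 'a list \<Rightarrow> bool" where
  "is_path V E vs \<longleftrightarrow>
     vs \<noteq> [] \<and> distinct vs \<and> set vs \<subseteq> V \<and> path_edges vs \<subseteq> E"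

definition cycle_edges :: "'a list \<Rightarrow> 'a set set" where
  "cycle_edges vs = insert {last vs, hd vs} (path_edges vs)"

definition is_cycle :: "'a set \<Rightarrow> 'a set set \<Rightarrow> 'a list \<Rightarrow> bool" where
  "is_cycle V E vs \<longleftrightarrow>
     3 \<le> length vs \<and> distinct vs \<and> set vs \<subseteq> V \<and> cycle_edges vs \<subseteq> E"

definition proper_edge_coloring :: "'a set set \<Rightarrow> ('a set \<Rightarrow> nat) \<Rightarrow> bool" where
  "proper_edge_coloring E f \<longleftrightarrow>
     (\<forall>e\<in>E. \<forall>e'\<in>E. e \<noteq> e' \<and> e \<inter> e' \<noteq> {} \<longrightarrow> f e \<noteq> f e')"

definition star_edge_coloring :: "'a set \<Rightarrow> 'a set set \<Rightarrow> ('a set \<Rightarrow> nat) \<Rightarrow> bool" where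
  "star_edge_coloring V E f \<longleftrightarrow>
     proper_edge_coloring E f \<and>
     (\<forall>vs. is_path V E vs \<and> card (path_edges vs) = 4 \<longrightarrow> \<not> card (f ` path_edges vs) \<le> 2) \<and>
     (\<forall>vs. is_cycle V E vs \<and> card (cycle_edges vs) = 4 \<longrightarrow> \<not> card (f ` cycle_edges vs) \<le> 2)"

definition colors_at :: "'a set set \<Rightarrow> ('a set \<Rightarrow> nat) \<Rightarrow> 'a \<Rightarrow> nat set" where
  "colors_at E f v = f ` {e \<in> E. v \<in> e}"

definition star_compatible ::
  "'a set \<Rightarrow> 'a set set \<Rightarrow> ('a set \<Rightarrow> nat) \<Rightarrow> ('a set \<Rightarrow> nat) \<Rightarrow> bool" where
  "star_compatible V E f g \<longleftrightarrow> (\<forall>v\<in>V. colors_at E f v \<inter> colors_at E g v = {})"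

definition star_colorable :: "'a set \<Rightarrow> 'a set set \<Rightarrow> nat \<Rightarrow> nat \<Rightarrow> bool" where
  "star_colorable V E k t \<longleftrightarrow>
     (\<exists>f :: nat \<Rightarrow> 'a set \<Rightarrow> nat.
        (\<forall>i\<in>{1..t}. star_edge_coloring V E (f i) \<and> f i ` E \<subseteq> {0..<k}) \<and>
        (\<forall>i\<in>{1..t}. \<forall>j\<in>{1..t}. i \<noteq> j \<longrightarrow> star_compatible V E (f i) (f j)))"

text \<open>The cycle on \<open>n\<close> vertices, meaningful for \<open>n \<ge> 3\<close>.\<close>

definition cycle_verts :: "nat \<Rightarrow> nat set" where
  "cycle_verts n = {0..<n}"

definition cycle_graph_edges :: "nat \<Rightarrow> nat set set" where
  "cycle_graph_edges n = {{i, Suc i mod n} | i. i < n}"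

lemma simple_graph_cycle:
  assumes "3 \<le> n"
  shows "simple_graph (cycle_verts n) (cycle_graph_edges n)"
proof -
  have "{i, Suc i mod n} \<subseteq> {0..<n} \<and> card {i, Suc i mod n} = 2" if "i < n" for i
  proof -
    have "i \<noteq> Suc i mod n"
      using assms that by (cases "Suc i = n") auto
    then show ?thesis
      using that by auto
  qed
  then show ?thesis
    unfolding simple_graph_def cycle_verts_def cycle_graph_edges_def by blast
qed

end

theory Submission
  imports Defs "HOL-Number_Theory.Cong"
begin

text \<open>
  Giving the \<open>i\<close>-th edge the set of its \<open>r\<close> colors turns pairwise compatible proper colorings into
  an assignment of \<open>r\<close>-sets to the edges of the cycle in which consecutive sets are disjoint. Cyclic
  intervals of residues modulo \<open>k = 2 * r + c\<close> do this: start at \<open>0\<close> and advance by \<open>r + e i\<close> with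
  \<open>0 \<le> e i \<le> c\<close>, where the total advance must be a multiple of \<open>k\<close>. The star condition
  says that no coloring repeats its colors with period two along four consecutive edges. The
  intervals two steps apart coincide exactly if \<open>e i + e (i + 1) = c\<close>, and rotating the order inside an
  interval breaks the remaining repetitions. Even cycles use \<open>c = 0\<close>; for \<open>n = 2 * m + 1\<close> the excess
  \<open>\<Sum>e = m * c - r\<close> makes the total advance \<open>m * k\<close>, and the minimal choice is \<open>c = \<lceil>r / m\<rceil>\<close>.
\<close>

section \<open>Edges and walks in the cycle\<close>

definition cyc_edge :: "nat \<Rightarrow> nat \<Rightarrow> nat set" where
  "cyc_edge n i = {i mod n, Suc i mod n}"

lemma cycle_graph_edges_eq: "cycle_graph_edges n = cyc_edge n ` {..<n}"
  unfolding cycle_graph_edges_def cyc_edge_def by auto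

lemma cyc_edge_mod [simp]: "cyc_edge n (i mod n) = cyc_edge n i"
  by (simp add: cyc_edge_def mod_Suc_eq)

lemma cyc_edge_inj:
  assumes "3 \<le> n"
  shows "inj_on (cyc_edge n) {..<n}"
proof (rule inj_onI)
  fix i j assume "i \<in> {..<n}" "j \<in> {..<n}" "cyc_edge n i = cyc_edge n j"
  then show "i = j"
    using assms by (auto simp: cyc_edge_def doubleton_eq_iff mod_Suc split: if_splits)
qed

lemma cyc_edge_disjoint:
  assumes "3 \<le> n" "i < n" "j < n" "cyc_edge n i \<inter> cyc_edge n j \<noteq> {}"
  shows "j = i \<or> j = Suc i mod n \<or> i = Suc j mod n"
  using assms by (auto simp: cyc_edge_def mod_Suc split: if_splits)

lemma cycle_graph_edgeD:
  assumes "{v, w} \<in> cycle_graph_edges n"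
  shows "v < n \<and> w < n \<and> (w = Suc v mod n \<or> v = Suc w mod n)"
  using assms unfolding cycle_graph_edges_def by (auto simp: doubleton_eq_iff)

lemma Suc_mod_inj:
  assumes "v < n" "w < n" "Suc v mod n = Suc w mod n"
  shows "v = w"
  using assms by (auto simp: mod_Suc split: if_splits)

text \<open>The endpoints may coincide, so this covers both paths and cycles with four edges.\<close>

lemma nonbacktracking_walk_edges:
  assumes E: "{v0, v1} \<in> cycle_graph_edges n" "{v1, v2} \<in> cycle_graph_edges n"
      "{v2, v3} \<in> cycle_graph_edges n" "{v3, v4} \<in> cycle_graph_edges n"
    and ne: "v0 \<noteq> v2" "v1 \<noteq> v3" "v2 \<noteq> v4"
  shows "\<exists>i<n. {{v0, v1}, {v1, v2}, {v2, v3}, {v3, v4}} =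
    {cyc_edge n i, cyc_edge n (i + 1), cyc_edge n (i + 2), cyc_edge n (i + 3)}"
proof -
  \<comment> \<open>A walk that never backtracks keeps the direction of its first step, so it runs
    forwards either from \<open>v0\<close> or, read in reverse, from \<open>v4\<close>.\<close>
  have fwd: "\<exists>i<n. {{w0, w1}, {w1, w2}, {w2, w3}, {w3, w4}} =
      {cyc_edge n i, cyc_edge n (i + 1), cyc_edge n (i + 2), cyc_edge n (i + 3)}"
    if "w0 < n" "w1 = Suc w0 mod n" "w2 = Suc w1 mod n" "w3 = Suc w2 mod n" "w4 = Suc w3 mod n"
    for w0 w1 w2 w3 w4
    using that by (intro exI[of _ w0]) (simp add: cyc_edge_def mod_Suc_eq eval_nat_numeral)
  have lt: "v0 < n" "v1 < n" "v2 < n" "v3 < n" "v4 < n"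
    using E cycle_graph_edgeD by blast+
  consider "v1 = Suc v0 mod n" | "v0 = Suc v1 mod n"
    using cycle_graph_edgeD[OF E(1)] by blast
  then show ?thesis
  proof cases
    case 1
    then have 2: "v2 = Suc v1 mod n"
      using cycle_graph_edgeD[OF E(2)] ne(1) lt Suc_mod_inj by metis
    then have 3: "v3 = Suc v2 mod n"
      using cycle_graph_edgeD[OF E(3)] ne(2) lt Suc_mod_inj by metis
    then have "v4 = Suc v3 mod n"
      using cycle_graph_edgeD[OF E(4)] ne(3) lt Suc_mod_inj by metis
    with fwd[of v0 v1 v2 v3 v4] 1 2 3 lt show ?thesis by blast
  next
    case 2
    then have 1: "v1 = Suc v2 mod n"
      using cycle_graph_edgeD[OF E(2)] ne(1) by metis
    then have 3: "v2 = Suc v3 mod n"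
      using cycle_graph_edgeD[OF E(3)] ne(2) by metis
    then have 4: "v3 = Suc v4 mod n"
      using cycle_graph_edgeD[OF E(4)] ne(3) by metis
    have "{{v0, v1}, {v1, v2}, {v2, v3}, {v3, v4}} = {{v4, v3}, {v3, v2}, {v2, v1}, {v1, v0}}"
      by (simp add: insert_commute)
    then show ?thesis
      using fwd[of v4 v3 v2 v1 v0] 1 2 3 4 lt by simp
  qed
qed

lemma path_edges_image: "path_edges vs = (\<lambda>i. {vs ! i, vs ! Suc i}) ` {..<length vs - 1}"
  unfolding path_edges_def by (force simp: less_diff_conv)

lemma path_edges_card:
  assumes "distinct vs"
  shows "card (path_edges vs) = length vs - 1"
proof -
  have "inj_on (\<lambda>i. {vs ! i, vs ! Suc i}) {..<length vs - 1}"
    using assms by (intro inj_onI) (auto simp: doubleton_eq_iff nth_eq_iff_index_eq)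
  then show ?thesis
    by (simp add: path_edges_image card_image)
qed

lemma path_edges_Cons_Cons: "path_edges (u # v # vs) = insert {u, v} (path_edges (v # vs))"
  by (simp add: path_edges_image lessThan_Suc_eq_insert_0 image_image)

lemma path_edges_single: "path_edges [v] = {}"
  by (simp add: path_edges_def)

section \<open>From color sequences to star colorings of the cycle\<close>

lemma card_four_le_two:
  assumes "card {a, b, c, d} \<le> 2" "a \<noteq> b" "b \<noteq> c" "c \<noteq> d"
  shows "a = c \<and> b = d"
  using assms by (auto simp: card_insert_if split: if_splits)

text \<open>Four-edge paths and cycles are windows of four consecutive edges; on a properly colored
  window two colors must alternate, which is the period-two pattern that \<open>star\<close>
  forbids.\<close>

lemma star_edge_coloring_cycleI:
  assumes n: "3 \<le> n"
    and f: "\<And>i. i < n \<Longrightarrow> f (cyc_edge n i) = g i"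
    and proper: "\<And>i. i < n \<Longrightarrow> g i \<noteq> g (Suc i mod n)"
    and star: "\<And>i. i < n \<Longrightarrow> g i \<noteq> g ((i + 2) mod n) \<or> g ((i + 1) mod n) \<noteq> g ((i + 3) mod n)"
  shows "star_edge_coloring (cycle_verts n) (cycle_graph_edges n) f"
proof -
  let ?E = "cycle_graph_edges n"
  have f': "f (cyc_edge n i) = g (i mod n)" for i
    using f[of "i mod n"] n by simp
  have walk: "\<not> card (f ` {{v0, v1}, {v1, v2}, {v2, v3}, {v3, v4}}) \<le> 2"
    if E: "{v0, v1} \<in> ?E" "{v1, v2} \<in> ?E" "{v2, v3} \<in> ?E" "{v3, v4} \<in> ?E"
      and ne: "v0 \<noteq> v2" "v1 \<noteq> v3" "v2 \<noteq> v4" for v0 v1 v2 v3 v4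
  proof
    assume le: "card (f ` {{v0, v1}, {v1, v2}, {v2, v3}, {v3, v4}}) \<le> 2"
    obtain i where i: "i < n" and eq: "{{v0, v1}, {v1, v2}, {v2, v3}, {v3, v4}} =
        {cyc_edge n i, cyc_edge n (i + 1), cyc_edge n (i + 2), cyc_edge n (i + 3)}"
      using nonbacktracking_walk_edges[OF E ne] by blast
    have "card {g i, g ((i + 1) mod n), g ((i + 2) mod n), g ((i + 3) mod n)} \<le> 2"
      using le i unfolding eq by (simp add: f')
    moreover have "g i \<noteq> g ((i + 1) mod n)" "g ((i + 1) mod n) \<noteq> g ((i + 2) mod n)"
        "g ((i + 2) mod n) \<noteq> g ((i + 3) mod n)"
      using proper[of i] proper[of "(i + 1) mod n"] proper[of "(i + 2) mod n"] i
      by (simp_all add: mod_Suc_eq numeral_3_eq_3)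
    ultimately have "g i = g ((i + 2) mod n) \<and> g ((i + 1) mod n) = g ((i + 3) mod n)"
      by (rule card_four_le_two)
    then show False
      using star[OF i] by blast
  qed
  have path: "\<not> card (f ` path_edges vs) \<le> 2"
    if vs: "distinct vs" "path_edges vs \<subseteq> ?E" "length vs = 5" for vs
  proof -
    obtain v0 v1 v2 v3 v4 where eq: "vs = [v0, v1, v2, v3, v4]"
      using vs(3) by (auto simp: eval_nat_numeral length_Suc_conv)
    have edges: "path_edges vs = {{v0, v1}, {v1, v2}, {v2, v3}, {v3, v4}}"
      unfolding eq path_edges_Cons_Cons path_edges_single ..
    then show ?thesis
      using walk[of v0 v1 v2 v3 v4] vs unfolding edges by (simp add: eq)
  qed
  have "proper_edge_coloring ?E f"
    unfolding proper_edge_coloring_def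
  proof (intro ballI impI)
    fix e e' assume "e \<in> ?E" "e' \<in> ?E" and ne: "e \<noteq> e' \<and> e \<inter> e' \<noteq> {}"
    then obtain i j where ij: "e = cyc_edge n i" "e' = cyc_edge n j" "i < n" "j < n"
      unfolding cycle_graph_edges_eq by blast
    then show "f e \<noteq> f e'"
      using cyc_edge_disjoint[OF n, of i j] ne proper[of i] proper[of j] by (auto simp: f)
  qed
  moreover have "\<not> card (f ` path_edges vs) \<le> 2"
    if "is_path (cycle_verts n) ?E vs" "card (path_edges vs) = 4" for vs
    using that path path_edges_card[of vs] unfolding is_path_def by simp
  moreover have "\<not> card (f ` cycle_edges vs) \<le> 2"
    if "is_cycle (cycle_verts n) ?E vs" "card (cycle_edges vs) = 4" for vs
  proof -
    have vs: "distinct vs" "insert {last vs, hd vs} (path_edges vs) \<subseteq> ?E" "3 \<le> length vs"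
      using that(1) unfolding is_cycle_def cycle_edges_def by auto
    have fin: "finite (cycle_edges vs)"
      using that(2) by (intro card_ge_0_finite) simp
    \<comment> \<open>The closing edge adds at most one edge. Five vertices would really give five
      edges, but it is simpler to settle that case by the four-edge path inside.\<close>
    have "card (path_edges vs) \<le> 4" "4 \<le> Suc (card (path_edges vs))"
      using that(2) fin unfolding cycle_edges_def by (auto simp: card_insert_if split: if_splits)
    then consider "length vs = 4" | "length vs = 5"
      using path_edges_card[OF vs(1)] vs(3) by linarith
    then show ?thesis
    proof cases
      case 1
      then obtain v0 v1 v2 v3 where eq: "vs = [v0, v1, v2, v3]"
        by (auto simp: eval_nat_numeral length_Suc_conv)
      have edges: "cycle_edges vs = {{v0, v1}, {v1, v2}, {v2, v3}, {v3, v0}}"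
        unfolding cycle_edges_def eq path_edges_Cons_Cons path_edges_single
        by (simp add: insert_commute)
      have "cycle_edges vs \<subseteq> ?E"
        using that(1) by (simp add: is_cycle_def)
      then show ?thesis
        using walk[of v0 v1 v2 v3 v0] vs(1) unfolding edges by (simp add: eq)
    next
      case 2
      have "card (f ` path_edges vs) \<le> card (f ` cycle_edges vs)"
        using fin by (intro card_mono) (auto simp: cycle_edges_def)
      then show ?thesis
        using path[OF vs(1) _ 2] vs(2) by simp
    qed
  qed
  ultimately show ?thesis
    unfolding star_edge_coloring_def by blast
qed

lemma colors_at_cycle:
  assumes "x \<in> colors_at (cycle_graph_edges n) f v"
  shows "\<exists>i<n. (v = i \<or> v = Suc i mod n) \<and> x = f (cyc_edge n i)"
  using assms unfolding colors_at_def cycle_graph_edges_eq cyc_edge_def by auto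

text \<open>Edges sharing a vertex are equal or consecutive, so \<open>diff\<close> and
  \<open>adj\<close> yield compatibility; \<open>adj\<close> with \<open>a = b\<close> is
  properness.\<close>

lemma star_colorable_cycleI:
  assumes n: "3 \<le> n"
    and bound: "\<And>a i. a < r \<Longrightarrow> i < n \<Longrightarrow> g a i < k"
    and diff: "\<And>a b i. a < r \<Longrightarrow> b < r \<Longrightarrow> a \<noteq> b \<Longrightarrow> i < n \<Longrightarrow> g a i \<noteq> g b i"
    and adj: "\<And>a b i. a < r \<Longrightarrow> b < r \<Longrightarrow> i < n \<Longrightarrow> g a i \<noteq> g b (Suc i mod n)"
    and star: "\<And>a i. a < r \<Longrightarrow> i < n \<Longrightarrow>
      g a i \<noteq> g a ((i + 2) mod n) \<or> g a ((i + 1) mod n) \<noteq> g a ((i + 3) mod n)"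
  shows "star_colorable (cycle_verts n) (cycle_graph_edges n) k r"
proof -
  let ?V = "cycle_verts n" and ?E = "cycle_graph_edges n"
  \<comment> \<open>\<open>star_colorable\<close> numbers the colorings from 1, \<open>g\<close>
    from 0.\<close>
  define f where "f a e = g (a - 1) (inv_into {..<n} (cyc_edge n) e)" for a :: nat and e
  have f: "f a (cyc_edge n i) = g (a - 1) i" if "i < n" for a i
    using that cyc_edge_inj[OF n] by (simp add: f_def inv_into_f_f)
  have "star_edge_coloring ?V ?E (f a) \<and> f a ` ?E \<subseteq> {0..<k}" if "a \<in> {1..r}" for a
  proof
    have a: "a - 1 < r" using that by auto
    show "star_edge_coloring ?V ?E (f a)"
      by (rule star_edge_coloring_cycleI[OF n, where g = "g (a - 1)"])
        (use f adj[OF a a] star[OF a] in auto)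
    show "f a ` ?E \<subseteq> {0..<k}"
      unfolding cycle_graph_edges_eq using bound[OF a] by (auto simp: f)
  qed
  moreover have "star_compatible ?V ?E (f a) (f b)"
    if ab: "a \<in> {1..r}" "b \<in> {1..r}" "a \<noteq> b" for a b
    unfolding star_compatible_def
  proof (intro ballI equals0I)
    fix v y assume v: "v \<in> ?V" and y: "y \<in> colors_at ?E (f a) v \<inter> colors_at ?E (f b) v"
    have lt: "a - 1 < r" "b - 1 < r" "a - 1 \<noteq> b - 1"
      using ab by auto
    obtain i where i: "i < n" "v = i \<or> v = Suc i mod n" "y = g (a - 1) i"
      using colors_at_cycle[of y n "f a" v] y f by auto
    obtain j where j: "j < n" "v = j \<or> v = Suc j mod n" "y = g (b - 1) j"
      using colors_at_cycle[of y n "f b" v] y f by auto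
    have "j = i \<or> j = Suc i mod n \<or> i = Suc j mod n"
      using i j Suc_mod_inj by metis
    then show False
      using diff[OF lt i(1)] adj[OF lt(1,2) i(1)] adj[OF lt(2,1) j(1)] i j by auto
  qed
  ultimately show ?thesis
    unfolding star_colorable_def by blast
qed

section \<open>Colorings from cyclic intervals of residues\<close>

text \<open>At position \<open>i\<close> the \<open>r\<close> colorings use the cyclic interval of \<open>r\<close> residues modulo \<open>2 * r + c\<close>
  starting at \<open>P i\<close>, rotated by \<open>x i\<close>. Successive intervals are disjoint because they
  are \<open>r + e i\<close> apart with \<open>e i \<le> c\<close>.\<close>

lemma star_colorable_intervals:
  fixes e x :: "nat \<Rightarrow> nat" and n r c :: nat
  assumes n: "3 \<le> n" and r: "2 \<le> r"
    and e: "\<And>i. e i \<le> c" and x: "\<And>i. x i < r"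
    and closed: "2 * r + c dvd r * n + sum e {..<n}"
    and star: "\<And>i. i < n \<Longrightarrow>
        (e i + e ((i + 1) mod n) = c) \<noteq> (x i = x ((i + 2) mod n)) \<or>
        (e ((i + 1) mod n) + e ((i + 2) mod n) = c) \<noteq> (x ((i + 1) mod n) = x ((i + 3) mod n))"
  shows "star_colorable (cycle_verts n) (cycle_graph_edges n) (2 * r + c) r"
proof -
  define k where "k = 2 * r + c"
  define P where "P i = r * i + sum e {..<i}" for i
  define h where "h a i = (a + x i) mod r" for a i
  define g where "g a i = (P i + h a i) mod k" for a i
  have h: "h a i < r" for a i
    using r by (simp add: h_def)
  \<comment> \<open>At the wrap \<open>P\<close> restarts at 0; \<open>closed\<close> makes this
    agree with the accumulated advance modulo \<open>k\<close>.\<close>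
  have P_step: "[P (Suc i mod n) = P i + r + e i] (mod k)" if "i < n" for i
  proof (cases "Suc i = n")
    case True
    then have "P i + r + e i = r * n + sum e {..<n}"
      by (auto simp: P_def)
    then have "[P i + r + e i = 0] (mod k)"
      using closed by (simp add: cong_0_iff k_def)
    then show ?thesis
      using True by (simp add: P_def cong_sym)
  next
    case False
    with that show ?thesis by (simp add: P_def algebra_simps)
  qed
  have P_step2: "[P ((i + 2) mod n) = P i + 2 * r + e i + e ((i + 1) mod n)] (mod k)"
    if "i < n" for i
  proof -
    have "[P (Suc (Suc i mod n) mod n) = P (Suc i mod n) + r + e (Suc i mod n)] (mod k)"
      using that by (intro P_step) auto
    also have "[P (Suc i mod n) + r + e (Suc i mod n) = (P i + r + e i) + r + e (Suc i mod n)] (mod k)"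
      by (intro cong_add P_step[OF that] cong_refl)
    finally show ?thesis
      by (simp add: mod_Suc_eq mult_2 add_ac)
  qed
  \<comment> \<open>Equal colors would make \<open>k\<close> divide a nonzero integer of absolute
    value below \<open>k\<close>.\<close>
  have noteq: "g a i \<noteq> g b j"
    if "[P j = P i + d] (mod k)" "h b j + d \<noteq> h a i" "\<bar>int (h b j + d) - int (h a i)\<bar> < int k" for a b i j d
  proof
    assume "g a i = g b j"
    then have "[P i + h a i = P j + h b j] (mod k)"
      by (simp add: g_def cong_def)
    also have "[P j + h b j = P i + d + h b j] (mod k)"
      by (intro cong_add that cong_refl)
    also have "P i + d + h b j = P i + (h b j + d)"
      by simp
    finally have "[h a i = h b j + d] (mod k)"
      by (rule cong_add_lcancel_nat[THEN iffD1])
    then have "[h b j + d = h a i] (mod k)"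
      by (rule cong_sym)
    then have "int k dvd int (h b j + d) - int (h a i)"
      by (simp only: cong_int_iff[symmetric] cong_iff_dvd_diff)
    moreover have "int (h b j + d) - int (h a i) \<noteq> 0"
      using that(2) by linarith
    ultimately have "\<bar>int k\<bar> \<le> \<bar>int (h b j + d) - int (h a i)\<bar>"
      by (intro dvd_imp_le_int)
    then show False
      using that(3) by linarith
  qed
  have h_inj: "s = t" if "(a + s) mod r = (a + t) mod r" "s < r" "t < r" for a s t
  proof -
    have "[a + s = a + t] (mod r)"
      using that(1) by (simp only: cong_def)
    then have "[s = t] (mod r)"
      by (rule cong_add_lcancel_nat[THEN iffD1])
    then show ?thesis
      using that(2,3) by (rule cong_less_modulus_unique_nat)
  qed
  \<comment> \<open>If the two excesses sum to \<open>c\<close>, the intervals coincide and the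
    rotations differ. Otherwise the rotations agree and the shift, \<open>s - c\<close> modulo
    \<open>k\<close>, is nonzero.\<close>
  have D: "g a i \<noteq> g a ((i + 2) mod n)"
    if i: "i < n" and d: "(e i + e ((i + 1) mod n) = c) \<noteq> (x i = x ((i + 2) mod n))" for a i
  proof -
    define j where "j = (i + 2) mod n"
    define s where "s = e i + e ((i + 1) mod n)"
    have s: "s \<le> 2 * c"
      using e[of i] e[of "(i + 1) mod n"] by (simp add: s_def)
    have P_j: "[P j = P i + (2 * r + s)] (mod k)"
      using P_step2[OF i] by (simp add: j_def s_def algebra_simps)
    have hne: "h a i \<noteq> h a j" if "x i \<noteq> x j"
      using that h_inj x unfolding h_def by blast
    have heq: "h a i = h a j" if "x i = x j"
      using that by (simp add: h_def)
    show ?thesis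
    proof (cases "s = c")
      case True
      with d have "x i \<noteq> x j" by (simp add: s_def j_def)
      moreover have "[P j = P i + 0] (mod k)"
        using P_j True by (simp add: cong_def k_def)
      ultimately show ?thesis
        using noteq[of j i 0 a a] hne h[of a i] h[of a j] by (auto simp: j_def k_def)
    next
      case False
      with d have eq: "h a i = h a j"
        using heq by (simp add: s_def j_def)
      show ?thesis
      proof (cases "c \<le> s")
        case True
        have "P i + (2 * r + s) = P i + (s - c) + k"
          using True by (simp add: k_def)
        with P_j have "[P j = P i + (s - c)] (mod k)"
          by (simp add: cong_def)
        then show ?thesis
          using noteq[of j i "s - c" a a] eq False True s r by (auto simp: j_def k_def)
      next
        case less: False
        then show ?thesis
          using noteq[OF P_j, of a a] eq r by (auto simp: j_def k_def)
      qed
    qed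
  qed
  show ?thesis
    unfolding k_def[symmetric]
  proof (rule star_colorable_cycleI[OF n, of r g])
    show "g a i < k" for a i
      using r by (simp add: g_def k_def)
    show "g a i \<noteq> g b i" if "a < r" "b < r" "a \<noteq> b" for a b i
    proof -
      have "h a i \<noteq> h b i"
        using that h_inj[of "x i" a b] by (auto simp: h_def add.commute)
      then show ?thesis
        using noteq[of i i 0 b a] h[of a i] h[of b i] by (auto simp: k_def)
    qed
    show "g a i \<noteq> g b (Suc i mod n)" if "i < n" for a b i
    \<comment> \<open>Both offsets are below \<open>r\<close> and \<open>e i \<le> c\<close>, so the
      difference lies between 1 and \<open>k - 1\<close>.\<close>
    proof (rule noteq[of _ _ "r + e i"])
      show "[P (Suc i mod n) = P i + (r + e i)] (mod k)"
        using P_step[OF that] by (simp add: add.assoc)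
    qed (use h[of a i] h[of b "Suc i mod n"] e[of i] in \<open>auto simp: k_def\<close>)
    show "g a i \<noteq> g a ((i + 2) mod n) \<or> g a ((i + 1) mod n) \<noteq> g a ((i + 3) mod n)"
      if "i < n" for a i
    proof -
      have "((i + 1) mod n + 1) mod n = (i + 2) mod n" "((i + 1) mod n + 2) mod n = (i + 3) mod n"
        by (simp_all add: mod_simps numeral_3_eq_3)
      then show ?thesis
        using D[of i a] D[of "(i + 1) mod n" a] star[OF that] that n by auto
    qed
  qed
qed

section \<open>Choice of excesses and rotations for even and odd cycles\<close>

lemma mod_less_double: "i mod n = (if i < n then i else i - n)" if "i < 2 * n" for i n :: nat
  using that by (simp add: mod_if)

lemma star_colorable_even_cycle:
  fixes n r :: nat
  assumes "4 \<le> n" "even n" "2 \<le> r"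
  shows "star_colorable (cycle_verts n) (cycle_graph_edges n) (2 * r) r"
proof -
  \<comment> \<open>With \<open>c = 0\<close> intervals two steps apart always coincide, so only
    \<open>x\<close> can separate the colors. Each window holds a pair of even positions two apart,
    where \<open>x\<close> alternates; this may fail from \<open>n - 2\<close> to 0 when
    \<open>n div 2\<close> is odd, and the 1 at \<open>n - 1\<close> repairs the windows
    there.\<close>
  define x :: "nat \<Rightarrow> nat" where
    "x i = (if even i then i div 2 mod 2 else of_bool (i = n - 1))" for i
  have x_alt: "x i \<noteq> x (i + 2)" if "even i" for i
    using that by (auto simp: x_def elim!: evenE) presburger+
  have x0: "x 0 = 0" "x 1 = 0" "x 2 = 1" "x (n - 1) = 1"
    using assms by (auto simp: x_def)
  have "x i \<noteq> x ((i + 2) mod n) \<or> x ((i + 1) mod n) \<noteq> x ((i + 3) mod n)" if "i < n" for i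
  proof -
    consider "i + 3 < n" | "i + 3 = n" | "i + 2 = n" | "i + 1 = n"
      using \<open>i < n\<close> by linarith
    then show ?thesis
    proof cases
      case 1
      then show ?thesis
        using x_alt[of i] x_alt[of "i + 1"] by (cases "even i") (auto simp: numeral_3_eq_3)
    next
      case 2
      then have "x i = 0" "(i + 2) mod n = n - 1"
        using assms by (auto simp: x_def)
      then show ?thesis using x0 by simp
    next
      case 3
      then have "(i + 1) mod n = n - 1" "(i + 3) mod n = 1"
        using assms by (auto simp: mod_less_double)
      then show ?thesis using x0 by simp
    next
      case 4
      then have "i = n - 1" "(i + 2) mod n = 1"
        using assms by (auto simp: mod_less_double)
      then show ?thesis using x0 by simp
    qed
  qed
  moreover have "x i < r" for i
    using assms(3) by (auto simp: x_def intro: less_le_trans[OF mod_less_divisor])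
  moreover have "2 * r dvd r * n"
    using assms(2) by auto
  ultimately show ?thesis
    using star_colorable_intervals[of n r "\<lambda>_. 0" 0 x] assms by simp
qed

text \<open>The bounds \<open>ge\<close> and \<open>lt\<close> say that \<open>c\<close> is the
  ceiling of \<open>r / m\<close>. The total excess \<open>d\<close> is then below \<open>m\<close>,
  so \<open>d\<close> wide steps of excess one fit, even pairwise nonadjacent.\<close>

lemma star_colorable_odd_cycle:
  fixes m r c :: nat
  assumes m: "1 \<le> m" and r: "2 \<le> r" and ge: "r \<le> m * c" and lt: "m * c < r + m"
  shows "star_colorable (cycle_verts (2 * m + 1)) (cycle_graph_edges (2 * m + 1)) (2 * r + c) r"
proof -
  define n where "n = 2 * m + 1"
  define d where "d = m * c - r"
  have d: "d < m"
    using ge lt by (simp add: d_def)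
  have closed: "2 * r + c dvd r * n + d"
  proof -
    have "r * n + d = (2 * r + c) * m"
      using ge by (simp add: n_def d_def algebra_simps)
    then show ?thesis by simp
  qed
  have "c \<noteq> 0"
    using ge r by (intro notI) simp
  then consider "c = 1" | "2 \<le> c" by linarith
  then have "star_colorable (cycle_verts n) (cycle_graph_edges n) (2 * r + c) r"
  proof cases
    case 1
    \<comment> \<open>The wide steps form one block, so coinciding intervals occur only at its two ends. These
      are adjacent if the block has length one, hence the rotation at \<open>n - 1\<close>.\<close>
    define e :: "nat \<Rightarrow> nat" where "e i = of_bool (i < d)" for i
    define x :: "nat \<Rightarrow> nat" where "x i = of_bool (i = n - 1)" for i
    have dm: "d + r = m"
      using ge 1 by (simp add: d_def)
    \<comment> \<open>Hence the last four steps are narrow, and windows across the wrap meet only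
      the front of the block.\<close>
    then have small: "d + 3 < n"
      using r by (simp add: n_def)
    have "{..<n} \<inter> {i. i < d} = {..<d}"
      using d by (auto simp: n_def)
    then have "sum e {..<n} = d"
      by (simp add: e_def)
    moreover have "(e i + e ((i + 1) mod n) = 1) \<noteq> (x i = x ((i + 2) mod n)) \<or>
        (e ((i + 1) mod n) + e ((i + 2) mod n) = 1) \<noteq> (x ((i + 1) mod n) = x ((i + 3) mod n))"
      if "i < n" for i
    proof -
      consider "i + 3 < n" | "i + 3 = n" | "i + 2 = n" | "i + 1 = n"
        using \<open>i < n\<close> by linarith
      then show ?thesis
      proof cases
        case 1
        then show ?thesis using small by (auto simp: e_def x_def)
      next
        case 2
        then have "(i + 1) mod n = n - 2" "(i + 2) mod n = n - 1" "(i + 3) mod n = 0"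
          by auto
        then show ?thesis
          using small by (auto simp: e_def x_def)
      next
        case 3
        then have "(i + 1) mod n = n - 1" "(i + 2) mod n = 0" "(i + 3) mod n = 1"
          using small by (auto simp: mod_less_double)
        then show ?thesis
          using 3 small by (auto simp: e_def x_def)
      next
        case 4
        then have "(i + 1) mod n = 0" "(i + 2) mod n = 1" "(i + 3) mod n = 2"
          using small by (auto simp: mod_less_double)
        then show ?thesis
          using 4 small by (auto simp: e_def x_def)
      qed
    qed
    ultimately show ?thesis
      using star_colorable_intervals[of n r e 1 x] 1 closed m r
      by (auto simp: e_def x_def n_def)
  next
    case 2
    \<comment> \<open>No two wide steps are adjacent, so intervals two steps apart never coincide.\<close>
    define e :: "nat \<Rightarrow> nat" where "e i = of_bool (even i \<and> i < 2 * d)" for i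
    have "sum e {..<n} = card ({..<n} \<inter> {i. even i \<and> i < 2 * d})"
      by (simp add: e_def)
    also have "{..<n} \<inter> {i. even i \<and> i < 2 * d} = (\<lambda>j. 2 * j) ` {..<d}"
      using d by (auto simp: n_def elim!: evenE)
    finally have "sum e {..<n} = d"
      by (simp add: card_image inj_on_def)
    moreover have small: "e i + e ((i + 1) mod n) \<noteq> c" if "i < n" for i
    proof (cases "Suc i = n")
      \<comment> \<open>The last position \<open>n - 1 = 2 * m\<close> is even but beyond
        \<open>2 * d\<close>, so its step is narrow.\<close>
      case True
      then have "e i = 0" "e ((i + 1) mod n) \<le> 1"
        using d by (auto simp: e_def n_def)
      then show ?thesis using 2 by linarith
    next
      case False
      then show ?thesis using 2 that by (auto simp: e_def)
    qed
    ultimately show ?thesis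
      using star_colorable_intervals[of n r e c "\<lambda>_. 0"] 2 closed m r
      by (auto simp: e_def n_def)
  qed
  then show ?thesis by (simp add: n_def)
qed

theorem theorem5:
  fixes n r :: nat
  assumes "n \<ge> 3" and "r \<ge> 2"
  shows "(n \<ge> 4 \<and> even n \<longrightarrow>
            star_colorable (cycle_verts n) (cycle_graph_edges n) (2 * r) r) \<and>
         (n \<ge> 2 * r + 1 \<and> odd n \<longrightarrow>
            star_colorable (cycle_verts n) (cycle_graph_edges n) (2 * r + 1) r) \<and>
         (n \<ge> 3 \<and> odd n \<longrightarrow>
            star_colorable (cycle_verts n) (cycle_graph_edges n)
              (2 * r + nat \<lceil>real (2 * r) / (real n - 1)\<rceil>) r)"
proof (intro conjI impI)
  assume "n \<ge> 4 \<and> even n"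
  then show "star_colorable (cycle_verts n) (cycle_graph_edges n) (2 * r) r"
    using star_colorable_even_cycle assms(2) by blast
next
  assume n: "n \<ge> 2 * r + 1 \<and> odd n"
  then obtain m where "n = 2 * m + 1"
    by (auto elim: oddE)
  \<comment> \<open>Here \<open>r \<le> m\<close>, so \<open>c = 1\<close> satisfies both
    bounds.\<close>
  then show "star_colorable (cycle_verts n) (cycle_graph_edges n) (2 * r + 1) r"
    using star_colorable_odd_cycle[of m r 1] n assms by simp
next
  assume "n \<ge> 3 \<and> odd n"
  then obtain m where n: "n = 2 * m + 1" and m: "1 \<le> m"
    by (auto elim!: oddE)
  \<comment> \<open>Since \<open>n - 1 = 2 * m\<close>, the ceiling in the claim is that of
    \<open>r / m\<close>.\<close>
  define c where "c = nat \<lceil>real r / real m\<rceil>"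
  have c: "real c = of_int \<lceil>real r / real m\<rceil>"
    by (simp add: c_def)
  have "real r / real m \<le> real c" "real c < real r / real m + 1"
    unfolding c by linarith+
  then have "real r \<le> real (m * c)" "real (m * c) < real (r + m)"
    using m by (simp_all add: field_simps)
  then have "r \<le> m * c" "m * c < r + m"
    by linarith+
  moreover have "real (2 * r) / (real n - 1) = real r / real m"
    by (simp add: n)
  ultimately show "star_colorable (cycle_verts n) (cycle_graph_edges n)
      (2 * r + nat \<lceil>real (2 * r) / (real n - 1)\<rceil>) r"
    using star_colorable_odd_cycle[OF m assms(2)] by (simp add: n c_def)
qed

end
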